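(* Let an instance of the Bilevel Knapsack with Interdiction Constraints (BKP) be given, with items sorted so that $p_1/w_1 \ge p_2/w_2 \ge \dots \ge p_n/w_n$. Let $z^*$ be its optimal value and let $x^*\in\{0,1\}^n$ be an optimal leader's solution. If $KP^{LP}(x^* )$ admits a critical item $c$ and model $CRIT_2(c)$ has a proper set $\mathcal{F}(\pi,x,k)$, then $z(CRIT_2(c))\le z^*$.
   Context: **Instance.** There are $n$ items. Item $i\in\{1,\dots,n\}$ has a profit $p_i>0$, a follower weight $w_i>0$ and a leader weight $v_i>0$. The leader's capacity is $C_u$ and the follower's capacity is $C_l$. All data are integers, with $v_i<C_u$ and $w_i<C_l$ for all $i$, $\sum_{i=1}^n v_i>C_u$ and $\sum_{i=1}^n w_i>C_l$. Items are sorted so that $p_1/w_1\ge p_2/w_2\ge\dots\ge p_n/w_n$. **Follower's problem.** For $x\in\{0,1\}^n$ let $S=\{i : x_i=0\}$. $KP(x)$ is the 0-1 knapsack problem of maximizing $\sum_{i=1}^n p_i y_i$ subject to $\sum_{i=1}^n w_i y_i\le C_l$, $y_i\le 1-x_i$ and $y_i\in\{0,1\}$ for all $i$. Its optimal value is $z(KP(x))$. **BKP.** $z^*=\min\{z(KP(x)) : x\in\{0,1\}^n,\ \sum_{i=1}^n v_i x_i\le C_u\}$. An optimal leader's solution $x^*$ is a minimizer. **Critical item.** $KP^{LP}(x)$ is the linear programming relaxation of $KP(x)$ (with $y_i\in\{0,1\}$ replaced by $y_i\in[0,1]$). Its optimal solution is taken to be the greedy one, which packs the items of $S$ in the given order until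 the capacity $C_l$ is exhausted, the last item possibly fractionally. A critical item exists if and only if $\sum_{i\in S}w_i>C_l$. In that case the critical item $c$ is the last item with a strictly positive value in this solution, i.e. the item $c\in S$ with $\sum_{i\in S,\,i<c}w_i<C_l\le\sum_{i\in S,\,i\le c}w_i$. The split solution packs exactly the items $i\in S$ with $i<c$. **Tuple constraints.** Fix an item $c$ and an integer $\delta\ge 0$. For a subset $\tau$ of the items in $\{c-\delta,\dots,c+\delta\}\cap\{1,\dots,n\}$ put $$p^\tau=-\sum_{i\in\tau,\,i<c}p_i+\sum_{j\in\tau,\,j\ge c}p_j,\qquad w^\tau=-\sum_{i\in\tau,\,i<c}w_i+\sum_{j\in\tau,\,j\ge c}w_j .$$ (The items of $\tau$ with index $<c$ are removed from the split solution, and those with index $\ge c$ are added.) The set $\mathcal{F}(\pi,x,k)$ is a finite collection of constraints $$\pi\ \ge\ p^\tau\Big(\sum_{j=\max\{1,w^\tau\}}^{w_c}k_j-\sum_{i\in\tau}x_i\Big),$$ one for each $\tau$ in some chosen family of such subsets with $p^\tau>0$ and $w^\tau\le w_c$. **Model $CRIT_2(c)$**, with variables $x\in\{0,1\}^n$, $k\in\{0,1\}^{w_c}$ and $\pi\in\mathbb{R}$: $$\min \sum_{i=1}^{c-1}p_i(1-x_i)+\pi$$ subject to all the constraints in $\mathcal{F}(\pi,x,k)$; $\ \sum_{i=1}^n v_ix_i\le C_u$; $\ \sum_{i=1}^{c-1}w_i(1-x_i)+\sum_{j=1}^{w_c}j\,k_j=C_l$; $\ \sum_{j=1}^{w_c}k_j=1$;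 $\ x_c=0$; $\ x_i\in\{0,1\}$ for $i=1,\dots,n$; $\ k_j\in\{0,1\}$ for $j=1,\dots,w_c$; $\ \pi\ge0$. **Proper.** The set $\mathcal{F}(\pi,x,k)$ is proper if in all its constraints only items not interdicted by the leader can be packed and the follower's capacity is not violated. Precisely: for every $\tau$ in the family and every $(x,k)$ satisfying the constraints of $CRIT_2(c)$ not involving $\pi$, if the right-hand side of the constraint for $\tau$ is positive, then $x_i=0$ for all $i\in\tau$ and $\sum_{i=1}^{c-1}w_i(1-x_i)+w^\tau\le C_l$. For a model $M$, $z(M)$ denotes its optimal value. *)

theory Defs
  imports "HOL-Analysis.Analysis"
begin

record bkp =
  num_items :: nat
  profit :: "nat \<Rightarrow> int"
  fweight :: "nat \<Rightarrow> int"  \<comment> \<open>follower weights \<open>w\<^sub>i\<close>\<close>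
  lweight :: "nat \<Rightarrow> int"  \<comment> \<open>leader weights \<open>v\<^sub>i\<close>\<close>
  lcap :: int
  fcap :: int

definition items :: "bkp \<Rightarrow> nat set" where
  "items I = {1..num_items I}"

definition bkp_instance :: "bkp \<Rightarrow> bool" where
  "bkp_instance I \<longleftrightarrow>
     (\<forall>i\<in>items I. profit I i > 0 \<and> fweight I i > 0 \<and> lweight I i > 0
        \<and> lweight I i < lcap I \<and> fweight I i < fcap I) \<and>
     (\<Sum>i\<in>items I. lweight I i) > lcap I \<and>
     (\<Sum>i\<in>items I. fweight I i) > fcap I \<and>
     (\<forall>i\<in>items I. \<forall>j\<in>items I. i \<le> j \<longrightarrow>
        real_of_int (profit I i) / real_of_int (fweight I i)
          \<ge> real_of_int (profit I j) / real_of_int (fweight I j))"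

text \<open>Zero-one vectors are extensional functions, so that there are finitely many of them.\<close>

definition binary :: "bkp \<Rightarrow> (nat \<Rightarrow> int) set" where
  "binary I = items I \<rightarrow>\<^sub>E {0, 1}"

definition kp_feasible :: "bkp \<Rightarrow> (nat \<Rightarrow> int) \<Rightarrow> (nat \<Rightarrow> int) set" where
  "kp_feasible I x = {y \<in> binary I.
     (\<Sum>i\<in>items I. fweight I i * y i) \<le> fcap I \<and> (\<forall>i\<in>items I. y i \<le> 1 - x i)}"

definition kp_value :: "bkp \<Rightarrow> (nat \<Rightarrow> int) \<Rightarrow> int" where
  "kp_value I x = Max ((\<lambda>y. \<Sum>i\<in>items I. profit I i * y i) ` kp_feasible I x)"

definition leader_feasible :: "bkp \<Rightarrow> (nat \<Rightarrow> int) set" where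
  "leader_feasible I = {x \<in> binary I. (\<Sum>i\<in>items I. lweight I i * x i) \<le> lcap I}"

definition bkp_value :: "bkp \<Rightarrow> int" where
  "bkp_value I = Min (kp_value I ` leader_feasible I)"

definition leader_optimal :: "bkp \<Rightarrow> (nat \<Rightarrow> int) \<Rightarrow> bool" where
  "leader_optimal I x \<longleftrightarrow>
     x \<in> leader_feasible I \<and> (\<forall>x'\<in>leader_feasible I. kp_value I x \<le> kp_value I x')"

definition free_items :: "bkp \<Rightarrow> (nat \<Rightarrow> int) \<Rightarrow> nat set" where
  "free_items I x = {i \<in> items I. x i = 0}"

definition kp_lp_feasible :: "bkp \<Rightarrow> (nat \<Rightarrow> int) \<Rightarrow> (nat \<Rightarrow> real) set" where
  "kp_lp_feasible I x = {y \<in> items I \<rightarrow>\<^sub>E {0..1}.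
     (\<Sum>i\<in>items I. real_of_int (fweight I i) * y i) \<le> real_of_int (fcap I) \<and>
     (\<forall>i\<in>items I. y i \<le> 1 - real_of_int (x i))}"

text \<open>The greedy solution gives item \<open>i\<close> the fraction that fits into the capacity left over by
  the non-interdicted items before \<open>i\<close>: all of it, part of it or nothing.\<close>

definition kp_lp_greedy :: "bkp \<Rightarrow> (nat \<Rightarrow> int) \<Rightarrow> nat \<Rightarrow> real" where
  "kp_lp_greedy I x = (\<lambda>i\<in>items I.
     if i \<in> free_items I x
     then min 1 (max 0 (real_of_int (fcap I - (\<Sum>j\<in>{j \<in> free_items I x. j < i}. fweight I j)))
                  / real_of_int (fweight I i))
     else 0)"

definition critical_item :: "bkp \<Rightarrow> (nat \<Rightarrow> int) \<Rightarrow> nat \<Rightarrow> bool" where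
  "critical_item I x c \<longleftrightarrow>
     (\<Sum>i\<in>free_items I x. fweight I i) > fcap I \<and>
     c \<in> items I \<and> kp_lp_greedy I x c > 0 \<and> (\<forall>i\<in>items I. i > c \<longrightarrow> kp_lp_greedy I x i = 0)"

definition tuple_profit :: "bkp \<Rightarrow> nat \<Rightarrow> nat set \<Rightarrow> int" where
  "tuple_profit I c \<tau> =
     - (\<Sum>i\<in>{i \<in> \<tau>. i < c}. profit I i) + (\<Sum>j\<in>{j \<in> \<tau>. j \<ge> c}. profit I j)"

definition tuple_weight :: "bkp \<Rightarrow> nat \<Rightarrow> nat set \<Rightarrow> int" where
  "tuple_weight I c \<tau> =
     - (\<Sum>i\<in>{i \<in> \<tau>. i < c}. fweight I i) + (\<Sum>j\<in>{j \<in> \<tau>. j \<ge> c}. fweight I j)"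

text \<open>A set of constraints \<open>\<F>(\<pi>,x,k)\<close> is given by the family \<open>T\<close> of its tuples.
  The truncation in \<open>c - \<delta>\<close> is harmless because items are numbered from 1.\<close>

definition tuple_family :: "bkp \<Rightarrow> nat \<Rightarrow> nat \<Rightarrow> nat set set \<Rightarrow> bool" where
  "tuple_family I c \<delta> T \<longleftrightarrow>
     (\<forall>\<tau>\<in>T. \<tau> \<subseteq> {c - \<delta>..c + \<delta>} \<inter> items I \<and>
        tuple_profit I c \<tau> > 0 \<and> tuple_weight I c \<tau> \<le> fweight I c)"

definition tuple_rhs :: "bkp \<Rightarrow> nat \<Rightarrow> nat set \<Rightarrow> (nat \<Rightarrow> int) \<Rightarrow> (int \<Rightarrow> int) \<Rightarrow> int" where
  "tuple_rhs I c \<tau> x k = tuple_profit I c \<tau> *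
     ((\<Sum>j\<in>{max 1 (tuple_weight I c \<tau>)..fweight I c}. k j) - (\<Sum>i\<in>\<tau>. x i))"

text \<open>The pairs \<open>(x, k)\<close> satisfying the constraints of \<open>CRIT\<^sub>2(c)\<close> that do not involve \<open>\<pi>\<close>.\<close>

definition crit2_base :: "bkp \<Rightarrow> nat \<Rightarrow> ((nat \<Rightarrow> int) \<times> (int \<Rightarrow> int)) set" where
  "crit2_base I c = {(x, k). x \<in> binary I \<and> k \<in> {1..fweight I c} \<rightarrow>\<^sub>E {0, 1} \<and>
     (\<Sum>i\<in>items I. lweight I i * x i) \<le> lcap I \<and>
     (\<Sum>i\<in>{1..<c}. fweight I i * (1 - x i)) + (\<Sum>j\<in>{1..fweight I c}. j * k j) = fcap I \<and>
     (\<Sum>j\<in>{1..fweight I c}. k j) = 1 \<and>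
     x c = 0}"

definition crit2_feasible ::
    "bkp \<Rightarrow> nat \<Rightarrow> nat set set \<Rightarrow> ((nat \<Rightarrow> int) \<times> (int \<Rightarrow> int) \<times> real) set" where
  "crit2_feasible I c T = {(x, k, \<pi>). (x, k) \<in> crit2_base I c \<and> \<pi> \<ge> 0 \<and>
     (\<forall>\<tau>\<in>T. \<pi> \<ge> real_of_int (tuple_rhs I c \<tau> x k))}"

definition crit2_objective :: "bkp \<Rightarrow> nat \<Rightarrow> (nat \<Rightarrow> int) \<times> (int \<Rightarrow> int) \<times> real \<Rightarrow> real" where
  "crit2_objective I c = (\<lambda>(x, k, \<pi>). real_of_int (\<Sum>i\<in>{1..<c}. profit I i * (1 - x i)) + \<pi>)"

text \<open>The infimum is taken in the extended reals, so that an infeasible model has value \<open>\<infinity>\<close>.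
  For a feasible model it is a minimum, see \<open>crit2_value_attained\<close> below.\<close>

definition crit2_value :: "bkp \<Rightarrow> nat \<Rightarrow> nat set set \<Rightarrow> ereal" where
  "crit2_value I c T = (INF s\<in>crit2_feasible I c T. ereal (crit2_objective I c s))"

definition proper :: "bkp \<Rightarrow> nat \<Rightarrow> nat set set \<Rightarrow> bool" where
  "proper I c T \<longleftrightarrow> (\<forall>\<tau>\<in>T. \<forall>(x, k)\<in>crit2_base I c. tuple_rhs I c \<tau> x k > 0 \<longrightarrow>
     (\<forall>i\<in>\<tau>. x i = 0) \<and>
     (\<Sum>i\<in>{1..<c}. fweight I i * (1 - x i)) + tuple_weight I c \<tau> \<le> fcap I)"

lemma finite_items [simp]: "finite (items I)"
  by (simp add: items_def)

lemma finite_free_items [simp]: "finite (free_items I x)"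
  by (simp add: free_items_def)

lemma critical_item_iff:
  assumes inst: "bkp_instance I"
  shows "critical_item I x c \<longleftrightarrow>
     (\<Sum>i\<in>free_items I x. fweight I i) > fcap I \<and> c \<in> free_items I x \<and>
     (\<Sum>i\<in>{i \<in> free_items I x. i < c}. fweight I i) < fcap I \<and>
     fcap I \<le> (\<Sum>i\<in>{i \<in> free_items I x. i \<le> c}. fweight I i)"
proof -
  let ?S = "free_items I x"
  let ?L = "\<lambda>i. \<Sum>j\<in>{j \<in> ?S. j < i}. fweight I j"
  let ?LE = "\<Sum>j\<in>{j \<in> ?S. j \<le> c}. fweight I j"
  have wpos: "fweight I i > 0" if "i \<in> items I" for i
    using inst that by (auto simp: bkp_instance_def)
  have SI: "i \<in> items I" if "i \<in> ?S" for i
    using that by (simp add: free_items_def)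
  have gpos: "kp_lp_greedy I x i > 0 \<longleftrightarrow> i \<in> ?S \<and> ?L i < fcap I" if "i \<in> items I" for i
    using that wpos[OF that]
    by (auto simp: kp_lp_greedy_def zero_less_divide_iff less_max_iff_disj simp del: of_int_sum of_int_diff)
  have gnn: "kp_lp_greedy I x i \<ge> 0" if "i \<in> items I" for i
    using that wpos[OF that] by (auto simp: kp_lp_greedy_def)
  have gz: "kp_lp_greedy I x i = 0 \<longleftrightarrow> \<not> (i \<in> ?S \<and> ?L i < fcap I)" if "i \<in> items I" for i
    using gpos[OF that] gnn[OF that] by linarith
  have "(\<forall>i\<in>items I. i > c \<longrightarrow> kp_lp_greedy I x i = 0) \<longleftrightarrow> fcap I \<le> ?LE"
    if big: "(\<Sum>i\<in>?S. fweight I i) > fcap I" and cS: "c \<in> ?S"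
  proof
    assume le: "fcap I \<le> ?LE"
    show "\<forall>i\<in>items I. i > c \<longrightarrow> kp_lp_greedy I x i = 0"
    proof (intro ballI impI)
      fix i assume i: "i \<in> items I" "i > c"
      have "?LE \<le> ?L i"
        using i by (intro sum_mono2) (auto dest: SI wpos intro: less_imp_le)
      then show "kp_lp_greedy I x i = 0" using le gz[OF i(1)] by linarith
    qed
  next
    assume z: "\<forall>i\<in>items I. i > c \<longrightarrow> kp_lp_greedy I x i = 0"
    show "fcap I \<le> ?LE"
    proof (cases "{i \<in> ?S. i > c} = {}")
      case True
      then have "{j \<in> ?S. j \<le> c} = ?S" by (auto simp: not_less)
      then show ?thesis using big by simp
    next
      case False
      define d where "d = Min {i \<in> ?S. i > c}"
      have d: "d \<in> {i \<in> ?S. i > c}" unfolding d_def using False by (intro Min_in) auto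
      have dmin: "d \<le> i" if "i \<in> ?S" "i > c" for i
        unfolding d_def using that by (intro Min_le) auto
      have "{j \<in> ?S. j < d} = {j \<in> ?S. j \<le> c}"
        using d dmin by (auto simp: not_less) (meson leD not_le)
      moreover have "\<not> ?L d < fcap I" using z d gz[of d] SI by auto
      ultimately show ?thesis by simp
    qed
  qed
  then show ?thesis
    using gpos[of c] SI[of c] unfolding critical_item_def by blast
qed

text \<open>The greedy solution is an optimal solution of the linear relaxation.\<close>

lemma kp_lp_greedy_partial_sum:
  assumes inst: "bkp_instance I" and cap: "fcap I \<ge> 0" and m: "m \<le> num_items I"
  shows "(\<Sum>i\<in>{1..m}. real_of_int (fweight I i) * kp_lp_greedy I x i) =
     min (real_of_int (fcap I)) (\<Sum>i\<in>{j \<in> free_items I x. j < Suc m}. real_of_int (fweight I i))"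
  using m
proof (induction m)
  case 0
  have E: "{j \<in> free_items I x. j < Suc 0} = {}" by (auto simp: free_items_def items_def)
  show ?case unfolding E using cap by simp
next
  case (Suc m)
  let ?S = "free_items I x"
  let ?W = "\<Sum>i\<in>{j \<in> ?S. j < Suc m}. real_of_int (fweight I i)"
  have it: "Suc m \<in> items I" using Suc.prems by (simp add: items_def)
  have w: "fweight I (Suc m) > 0" using inst it by (auto simp: bkp_instance_def)
  have IH: "(\<Sum>i\<in>{1..m}. real_of_int (fweight I i) * kp_lp_greedy I x i) = min (real_of_int (fcap I)) ?W"
    using Suc by simp
  show ?case
  proof (cases "Suc m \<in> ?S")
    case True
    have "{j \<in> ?S. j < Suc (Suc m)} = insert (Suc m) {j \<in> ?S. j < Suc m}"
      using True by auto
    then have W: "(\<Sum>i\<in>{j \<in> ?S. j < Suc (Suc m)}. real_of_int (fweight I i))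
        = real_of_int (fweight I (Suc m)) + ?W" by simp
    have "real_of_int (fweight I (Suc m)) * kp_lp_greedy I x (Suc m)
        = min (real_of_int (fweight I (Suc m))) (max 0 (real_of_int (fcap I) - ?W))"
      using True it w by (auto simp: kp_lp_greedy_def min_def field_simps)
    then show ?thesis using IH W w by auto
  next
    case False
    then have "{j \<in> ?S. j < Suc (Suc m)} = {j \<in> ?S. j < Suc m}"
      using less_Suc_eq by auto
    then show ?thesis using False IH it by (simp add: kp_lp_greedy_def)
  qed
qed

lemma kp_lp_greedy_feasible:
  assumes inst: "bkp_instance I" and x: "x \<in> binary I" and cap: "fcap I \<ge> 0"
  shows "kp_lp_greedy I x \<in> kp_lp_feasible I x"
proof -
  have wpos: "fweight I i > 0" if "i \<in> items I" for i
    using inst that by (auto simp: bkp_instance_def)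
  have "kp_lp_greedy I x i \<in> {0..1}" if "i \<in> items I" for i
    using that wpos[OF that] by (auto simp: kp_lp_greedy_def)
  then have "kp_lp_greedy I x \<in> items I \<rightarrow>\<^sub>E {0..1}"
    by (auto simp: kp_lp_greedy_def)
  moreover have "(\<Sum>i\<in>items I. real_of_int (fweight I i) * kp_lp_greedy I x i) \<le> real_of_int (fcap I)"
    using kp_lp_greedy_partial_sum[OF inst cap order_refl, of x] by (simp add: items_def)
  moreover have "kp_lp_greedy I x i \<le> 1 - real_of_int (x i)" if "i \<in> items I" for i
  proof -
    have "x i \<in> {0, 1}" using x that by (auto simp: binary_def PiE_iff)
    then show ?thesis using that by (auto simp: kp_lp_greedy_def free_items_def)
  qed
  ultimately show ?thesis by (simp add: kp_lp_feasible_def)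
qed

lemma kp_lp_greedy_optimal:
  assumes inst: "bkp_instance I" and x: "x \<in> binary I" and cap: "fcap I \<ge> 0"
    and y: "y \<in> kp_lp_feasible I x"
  shows "(\<Sum>i\<in>items I. real_of_int (profit I i) * y i)
      \<le> (\<Sum>i\<in>items I. real_of_int (profit I i) * kp_lp_greedy I x i)"
proof -
  let ?S = "free_items I x"
  let ?w = "\<lambda>i. real_of_int (fweight I i)"
  define r where "r i = real_of_int (profit I i) / ?w i" for i
  define d where "d i = ?w i * kp_lp_greedy I x i - ?w i * y i" for i
  have wpos: "?w i > 0" and ppos: "profit I i > 0" if "i \<in> items I" for i
    using inst that by (auto simp: bkp_instance_def)
  have rmono: "r j \<le> r i" if "i \<in> items I" "j \<in> items I" "i \<le> j" for i j
    using inst that by (auto simp: bkp_instance_def r_def)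
  have y01: "0 \<le> y i" "y i \<le> 1" if "i \<in> items I" for i
    using y that by (auto simp: kp_lp_feasible_def PiE_iff)
  have y0: "y i = 0" if "i \<in> items I" "i \<notin> ?S" for i
  proof -
    have "x i = 1" using x that by (auto simp: binary_def free_items_def PiE_iff)
    moreover have "y i \<le> 1 - real_of_int (x i)" using y that by (auto simp: kp_lp_feasible_def)
    ultimately show ?thesis using y01[OF that(1)] by simp
  qed
  have D: "(\<Sum>i\<in>{1..m}. d i) \<ge> 0" if m: "m \<le> num_items I" for m
  proof -
    have sub: "{1..m} \<subseteq> items I" using m by (auto simp: items_def)
    have "(\<Sum>i\<in>{1..m}. ?w i * y i) \<le> (\<Sum>i\<in>items I. ?w i * y i)"
    proof (rule sum_mono2[OF finite_items sub])
      fix i assume "i \<in> items I - {1..m}"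
      then show "0 \<le> ?w i * y i" using wpos[of i] y01[of i] by simp
    qed
    also have "\<dots> \<le> real_of_int (fcap I)" using y by (simp add: kp_lp_feasible_def)
    finally have 1: "(\<Sum>i\<in>{1..m}. ?w i * y i) \<le> real_of_int (fcap I)" .
    have "(\<Sum>i\<in>{1..m}. ?w i * y i) = (\<Sum>i\<in>{j \<in> ?S. j < Suc m}. ?w i * y i)"
    proof (rule sum.mono_neutral_right)
      show "{j \<in> ?S. j < Suc m} \<subseteq> {1..m}" by (auto simp: free_items_def items_def)
      show "\<forall>i\<in>{1..m} - {j \<in> ?S. j < Suc m}. ?w i * y i = 0" using sub y0 by force
    qed simp
    also have "\<dots> \<le> (\<Sum>i\<in>{j \<in> ?S. j < Suc m}. ?w i)"
    proof (rule sum_mono)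
      fix i assume "i \<in> {j \<in> ?S. j < Suc m}"
      then have "i \<in> items I" by (simp add: free_items_def)
      then show "?w i * y i \<le> ?w i"
        using wpos[of i] y01[of i] mult_left_le[of "y i" "?w i"] by simp
    qed
    finally show ?thesis
      using 1 kp_lp_greedy_partial_sum[OF inst cap m, of x] by (simp add: d_def sum_subtractf)
  qed
  have A: "(\<Sum>i\<in>{1..m}. r i * d i) \<ge> r m * (\<Sum>i\<in>{1..m}. d i)"
    if "m \<le> num_items I" "m \<ge> 1" for m
    using that(2,1)
  proof (induction m rule: dec_induct)
    case base
    then show ?case by simp
  next
    case (step m)
    have "r (Suc m) * (\<Sum>i\<in>{1..m}. d i) \<le> r m * (\<Sum>i\<in>{1..m}. d i)"
      using step D[of m] by (intro mult_right_mono rmono) (auto simp: items_def)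
    then show ?case using step by (simp add: distrib_left)
  qed
  have "(\<Sum>i\<in>items I. r i * d i) \<ge> 0"
  proof (cases "num_items I = 0")
    case True
    then show ?thesis by (simp add: items_def)
  next
    case False
    let ?n = "num_items I"
    have n: "?n \<in> items I" using False by (simp add: items_def)
    have "r ?n \<ge> 0" using ppos[OF n] wpos[OF n] by (simp add: r_def)
    then have "0 \<le> r ?n * (\<Sum>i\<in>{1..?n}. d i)" using D[of ?n] by simp
    also have "\<dots> \<le> (\<Sum>i\<in>{1..?n}. r i * d i)" using A[of ?n] False by simp
    finally show ?thesis by (simp add: items_def)
  qed
  also have "(\<Sum>i\<in>items I. r i * d i) =
      (\<Sum>i\<in>items I. real_of_int (profit I i) * kp_lp_greedy I x i - real_of_int (profit I i) * y i)"
  proof (rule sum.cong)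
    fix i assume "i \<in> items I"
    then have "?w i \<noteq> 0" using wpos[of i] by simp
    then show "r i * d i = real_of_int (profit I i) * kp_lp_greedy I x i - real_of_int (profit I i) * y i"
      by (simp add: r_def d_def field_simps)
  qed simp
  finally show ?thesis by (simp add: sum_subtractf)
qed

lemma crit2_value_attained:
  assumes fam: "tuple_family I c \<delta> T" and ne: "crit2_feasible I c T \<noteq> {}"
  shows "\<exists>s\<in>crit2_feasible I c T. crit2_value I c T = ereal (crit2_objective I c s)"
proof -
  have "T \<subseteq> Pow (items I)" using fam by (auto simp: tuple_family_def)
  then have finT: "finite T" by (rule finite_subset) simp
  have "crit2_base I c \<subseteq> binary I \<times> ({1..fweight I c} \<rightarrow>\<^sub>E {0, 1})"
    by (auto simp: crit2_base_def)
  then have finB: "finite (crit2_base I c)"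
    by (rule finite_subset) (auto simp: binary_def intro!: finite_PiE)
  define P where "P = (\<lambda>(x, k). Max (insert 0 ((\<lambda>\<tau>. real_of_int (tuple_rhs I c \<tau> x k)) ` T)))"
  define f where "f = (\<lambda>(x, k). crit2_objective I c (x, k, P (x, k)))"
  have feas: "(x, k, \<pi>) \<in> crit2_feasible I c T \<longleftrightarrow> (x, k) \<in> crit2_base I c \<and> P (x, k) \<le> \<pi>" for x k \<pi>
    using finT by (auto simp: crit2_feasible_def P_def)
  have neB: "crit2_base I c \<noteq> {}" using ne by (auto simp: crit2_feasible_def)
  then obtain b where b: "b \<in> crit2_base I c" "\<And>b'. b' \<in> crit2_base I c \<Longrightarrow> f b \<le> f b'"
    using ex_min_if_finite[of "f ` crit2_base I c"] finB
    by (metis (no_types, lifting) arg_min_if_finite(1) arg_min_least)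
  obtain x k where xk: "b = (x, k)" by (cases b)
  let ?s = "(x, k, P (x, k))"
  have s: "?s \<in> crit2_feasible I c T" using b(1) xk feas by auto
  have le: "crit2_objective I c ?s \<le> crit2_objective I c s'" if "s' \<in> crit2_feasible I c T" for s'
  proof -
    obtain x' k' \<pi>' where s': "s' = (x', k', \<pi>')" by (cases s')
    then have "(x', k') \<in> crit2_base I c" "P (x', k') \<le> \<pi>'" using that feas by auto
    then show ?thesis using b(2)[of "(x', k')"] xk s' by (auto simp: f_def crit2_objective_def)
  qed
  have "crit2_value I c T = ereal (crit2_objective I c ?s)"
    unfolding crit2_value_def
    by (rule antisym) (auto intro!: INF_lower2[OF s] INF_greatest simp: le)
  then show ?thesis using s by blast
qed

end

(* Extend xopt to a point of the model by letting k select the residual capacity of the split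
   solution and by setting \<pi> to z(KP(xopt)) minus the profit of the split solution, so that the
   objective value is exactly z(KP(xopt)) = z*. This \<pi> is nonnegative because the split solution
   is feasible for the follower, and it satisfies a tuple constraint with positive right-hand side
   because properness makes the exchange of the split solution by the tuple feasible as well. *)

theory Submission
  imports Defs
begin

lemma finite_binary [simp]: "finite (binary I)"
  by (auto simp: binary_def intro!: finite_PiE)

text \<open>The indicator vector of \<open>A\<close> is a follower solution. Both lower bounds on
  the follower's value come from here: one for the split set, one for the split set after an
  exchange.\<close>

lemma kp_value_ge_packing:
  assumes x: "x \<in> binary I" and A: "A \<subseteq> free_items I x"
    and cap: "(\<Sum>i\<in>A. fweight I i) \<le> fcap I"
  shows "(\<Sum>i\<in>A. profit I i) \<le> kp_value I x"
proof -
  define y where "y = (\<lambda>i\<in>items I. if i \<in> A then 1 else 0 :: int)"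
  have sub: "A \<subseteq> items I" using A by (auto simp: free_items_def)
  have sum_y: "(\<Sum>i\<in>items I. f i * y i) = (\<Sum>i\<in>A. f i)" for f :: "nat \<Rightarrow> int"
  proof -
    have "(\<Sum>i\<in>items I. f i * y i) = (\<Sum>i\<in>items I. if i \<in> A then f i else 0)"
      by (intro sum.cong) (auto simp: y_def)
    also have "\<dots> = (\<Sum>i\<in>A. f i)"
      using sub by (simp add: sum.inter_restrict[symmetric] inf.absorb2)
    finally show ?thesis .
  qed
  have "y i \<le> 1 - x i" if "i \<in> items I" for i
    using that x A by (auto simp: y_def binary_def free_items_def PiE_iff)
  moreover have "y \<in> binary I" by (auto simp: y_def binary_def)
  ultimately have "y \<in> kp_feasible I x"
    using cap by (simp add: kp_feasible_def sum_y)
  moreover have "finite (kp_feasible I x)"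
    by (rule finite_subset[OF _ finite_binary[of I]]) (auto simp: kp_feasible_def)
  ultimately have "(\<Sum>i\<in>items I. profit I i * y i) \<le> kp_value I x"
    unfolding kp_value_def by (intro Max_ge) auto
  then show ?thesis by (simp add: sum_y)
qed

lemma bkp_value_eq_kp_value:
  assumes "leader_optimal I x"
  shows "bkp_value I = kp_value I x"
proof -
  have "finite (leader_feasible I)"
    by (rule finite_subset[OF _ finite_binary[of I]]) (auto simp: leader_feasible_def)
  then show ?thesis
    using assms unfolding bkp_value_def leader_optimal_def by (intro Min_eqI) auto
qed

definition split_items :: "bkp \<Rightarrow> (nat \<Rightarrow> int) \<Rightarrow> nat \<Rightarrow> nat set" where
  "split_items I x c = {i \<in> free_items I x. i < c}"

lemma finite_split_items [simp]: "finite (split_items I x c)"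
  by (simp add: split_items_def)

text \<open>Bridge from the model, which weights all items below \<open>c\<close> by
  \<open>1 - x i\<close>, to sets: for binary \<open>x\<close> this factor is 1 on the split set and
  0 on the other items below \<open>c\<close>.\<close>

lemma sum_split_items:
  fixes f :: "nat \<Rightarrow> int"
  assumes "x \<in> binary I" and "c \<in> items I"
  shows "(\<Sum>i\<in>{1..<c}. f i * (1 - x i)) = (\<Sum>i\<in>split_items I x c. f i)"
proof (rule sum.mono_neutral_cong_right)
  show "\<forall>i\<in>{1..<c} - split_items I x c. f i * (1 - x i) = 0"
    using assms by (auto simp: split_items_def free_items_def items_def binary_def PiE_iff)
qed (auto simp: split_items_def free_items_def items_def)

definition exchange :: "nat \<Rightarrow> nat set \<Rightarrow> nat set \<Rightarrow> nat set" where
  "exchange c \<tau> A = (A - {i \<in> \<tau>. i < c}) \<union> {i \<in> \<tau>. i \<ge> c}"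

text \<open>Kept general in \<open>f\<close> to serve both profits and weights, where the bracket
  becomes \<open>tuple_profit\<close> or \<open>tuple_weight\<close>. The negative terms count real
  removals because the items of \<tau> below \<open>c\<close> lie in \<open>A\<close>; the added
  items are new because \<open>A\<close> stays below \<open>c\<close>.\<close>

lemma sum_exchange:
  fixes f :: "nat \<Rightarrow> int"
  assumes "finite A" and "finite \<tau>" and "\<forall>i\<in>A. i < c" and "{i \<in> \<tau>. i < c} \<subseteq> A"
  shows "(\<Sum>i\<in>exchange c \<tau> A. f i)
    = (\<Sum>i\<in>A. f i) + (- (\<Sum>i\<in>{i \<in> \<tau>. i < c}. f i) + (\<Sum>i\<in>{i \<in> \<tau>. i \<ge> c}. f i))"
proof -
  have "(A - {i \<in> \<tau>. i < c}) \<inter> {i \<in> \<tau>. i \<ge> c} = {}" using assms(3) by auto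
  then show ?thesis
    using assms by (simp add: exchange_def sum.union_disjoint sum_diff)
qed

text \<open>Criticality puts the residual capacity \<open>r\<close> into the index range of
  \<open>k\<close>: its strict inequality gives \<open>r\<close> \<ge> 1 by integrality, the other
  one gives \<open>r\<close> \<le> \<open>fweight I c\<close>. The unit vector at \<open>r\<close>
  then balances the capacity equation.\<close>

lemma crit2_base_residual:
  assumes inst: "bkp_instance I" and x: "x \<in> leader_feasible I" and crit: "critical_item I x c"
  defines "r \<equiv> fcap I - (\<Sum>i\<in>split_items I x c. fweight I i)"
  shows "(x, \<lambda>j\<in>{1..fweight I c}. if j = r then 1 else 0) \<in> crit2_base I c"
proof -
  have c: "c \<in> free_items I x" and lo: "(\<Sum>i\<in>split_items I x c. fweight I i) < fcap I"
    and hi: "fcap I \<le> (\<Sum>i\<in>{i \<in> free_items I x. i \<le> c}. fweight I i)"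
    using crit by (auto simp: critical_item_iff[OF inst] split_items_def)
  have "{i \<in> free_items I x. i \<le> c} = insert c (split_items I x c)"
    using c by (auto simp: split_items_def)
  then have "fcap I \<le> fweight I c + (\<Sum>i\<in>split_items I x c. fweight I i)"
    using hi by (simp add: split_items_def)
  then have r: "r \<in> {1..fweight I c}" using lo by (simp add: r_def)
  have xb: "x \<in> binary I" and ci: "c \<in> items I" and xc: "x c = 0"
    using x c by (auto simp: leader_feasible_def free_items_def)
  have "(\<Sum>j\<in>{1..fweight I c}. j * (if j = r then 1 else 0)) = r"
    using r by (simp add: if_distrib cong: if_cong)
  moreover have "(\<Sum>j\<in>{1..fweight I c}. if j = r then 1 else 0 :: int) = 1"
    using r by simp
  ultimately show ?thesis
    using x xc by (auto simp: crit2_base_def leader_feasible_def sum_split_items[OF xb ci] r_def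
        simp del: One_nat_def)
qed

text \<open>The bracket in \<open>tuple_rhs\<close> is at most 1: it subtracts a nonnegative number
  from a partial sum of the nonnegative \<open>k j\<close>, whose total is 1.\<close>

lemma tuple_rhs_le_tuple_profit:
  assumes base: "(x, k) \<in> crit2_base I c" and \<tau>: "\<tau> \<subseteq> items I"
    and pos: "tuple_profit I c \<tau> \<ge> 0"
  shows "tuple_rhs I c \<tau> x k \<le> tuple_profit I c \<tau>"
proof -
  have k: "k \<in> {1..fweight I c} \<rightarrow>\<^sub>E {0, 1}" and k1: "(\<Sum>j\<in>{1..fweight I c}. k j) = 1"
    and x: "x \<in> binary I"
    using base by (auto simp: crit2_base_def)
  have "k j \<ge> 0" if "j \<in> {1..fweight I c}" for j
    using PiE_mem[OF k that] by auto
  then have "(\<Sum>j\<in>{max 1 (tuple_weight I c \<tau>)..fweight I c}. k j) \<le> (\<Sum>j\<in>{1..fweight I c}. k j)"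
    by (intro sum_mono2) auto
  moreover have "x i \<ge> 0" if "i \<in> \<tau>" for i
    using PiE_mem[OF x[unfolded binary_def]] that \<tau> by fastforce
  then have "(\<Sum>i\<in>\<tau>. x i) \<ge> 0"
    by (rule sum_nonneg)
  ultimately show ?thesis
    unfolding tuple_rhs_def using pos k1 by (intro mult_left_le) auto
qed

lemma proper_tuple_rhs_le:
  assumes base: "(x, k) \<in> crit2_base I c" and c: "c \<in> items I"
    and fam: "tuple_family I c \<delta> T" and proper: "proper I c T" and \<tau>: "\<tau> \<in> T"
    and pos: "tuple_rhs I c \<tau> x k > 0"
  shows "(\<Sum>i\<in>split_items I x c. profit I i) + tuple_rhs I c \<tau> x k \<le> kp_value I x"
proof -
  let ?A = "split_items I x c"
  have x: "x \<in> binary I" using base by (simp add: crit2_base_def)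
  have sub: "\<tau> \<subseteq> items I" and p: "tuple_profit I c \<tau> > 0"
    using fam \<tau> by (auto simp: tuple_family_def)
  have "(\<forall>i\<in>\<tau>. x i = 0) \<and>
      (\<Sum>i\<in>{1..<c}. fweight I i * (1 - x i)) + tuple_weight I c \<tau> \<le> fcap I"
    using bspec[OF bspec[OF proper[unfolded proper_def] \<tau>] base] pos by simp
  then have free: "\<tau> \<subseteq> free_items I x"
    and w: "(\<Sum>i\<in>?A. fweight I i) + tuple_weight I c \<tau> \<le> fcap I"
    using sub by (auto simp: free_items_def sum_split_items[OF x c] simp del: One_nat_def)
  \<comment> \<open>Every item of \<tau> is free, so those below \<open>c\<close> belong to the
    split set and can be removed from it.\<close>
  have exch: "(\<Sum>i\<in>exchange c \<tau> ?A. f i)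
      = (\<Sum>i\<in>?A. f i) + (- (\<Sum>i\<in>{i \<in> \<tau>. i < c}. f i) + (\<Sum>i\<in>{i \<in> \<tau>. i \<ge> c}. f i))"
    for f :: "nat \<Rightarrow> int"
    using free finite_subset[OF sub] by (intro sum_exchange) (auto simp: split_items_def)
  have "(\<Sum>i\<in>exchange c \<tau> ?A. profit I i) \<le> kp_value I x"
  proof (rule kp_value_ge_packing[OF x])
    show "exchange c \<tau> ?A \<subseteq> free_items I x"
      using free by (auto simp: exchange_def split_items_def)
    show "(\<Sum>i\<in>exchange c \<tau> ?A. fweight I i) \<le> fcap I"
      using w by (simp add: exch tuple_weight_def)
  qed
  then have "(\<Sum>i\<in>?A. profit I i) + tuple_profit I c \<tau> \<le> kp_value I x"
    by (simp add: exch tuple_profit_def)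
  then show ?thesis
    using tuple_rhs_le_tuple_profit[OF base sub] p by linarith
qed

theorem proposition2:
  fixes I :: bkp and xopt :: "nat \<Rightarrow> int" and c \<delta> :: nat and T :: "nat set set"
  assumes "bkp_instance I"
    and "leader_optimal I xopt"
    and "critical_item I xopt c"
    and "tuple_family I c \<delta> T"
    and "proper I c T"
  shows "crit2_value I c T \<le> ereal (real_of_int (bkp_value I))"
proof -
  let ?A = "split_items I xopt c"
  define \<pi> where "\<pi> = kp_value I xopt - (\<Sum>i\<in>?A. profit I i)"
  have lf: "xopt \<in> leader_feasible I" using assms(2) by (simp add: leader_optimal_def)
  then have x: "xopt \<in> binary I" by (simp add: leader_feasible_def)
  have c: "c \<in> items I" using assms(3) by (simp add: critical_item_def)
  \<comment> \<open>Any \<open>k\<close> completing \<open>xopt\<close> to a base point will do: the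
    bound on the right-hand sides holds for all of them.\<close>
  obtain k where base: "(xopt, k) \<in> crit2_base I c"
    using crit2_base_residual[OF assms(1) lf assms(3)] by blast
  have "(\<Sum>i\<in>?A. fweight I i) \<le> fcap I"
    using assms(3) by (auto simp: critical_item_iff[OF assms(1)] split_items_def)
  then have \<pi>0: "\<pi> \<ge> 0"
    unfolding \<pi>_def using kp_value_ge_packing[OF x, of ?A] by (auto simp: split_items_def)
  \<comment> \<open>A right-hand side that is not positive is bounded through \<open>\<pi>0\<close>;
    properness is called upon only for the positive ones.\<close>
  have "tuple_rhs I c \<tau> xopt k \<le> \<pi>" if "\<tau> \<in> T" for \<tau>
    using proper_tuple_rhs_le[OF base c assms(4,5) that] \<pi>0
    unfolding \<pi>_def by linarith
  then have "(xopt, k, real_of_int \<pi>) \<in> crit2_feasible I c T"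
    using base \<pi>0 by (simp add: crit2_feasible_def)
  then have "crit2_value I c T \<le> ereal (crit2_objective I c (xopt, k, real_of_int \<pi>))"
    unfolding crit2_value_def by (rule INF_lower)
  also have "crit2_objective I c (xopt, k, real_of_int \<pi>) = real_of_int (kp_value I xopt)"
    unfolding crit2_objective_def prod.case sum_split_items[OF x c] by (simp add: \<pi>_def)
  finally show ?thesis by (simp add: bkp_value_eq_kp_value[OF assms(2)])
qed

end
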